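(* Let $T$ be a tournament of order $n$ with $\mathrm{inv}(T) = 1$. Then $\mathrm{inv}(T[D_1, \ldots,D_n]) =n+1$ for all oriented graphs $D_1,\dots,D_n$ with $\mathrm{inv}(D_i)=1$ for every $1\le i\le n$. Moreover, $\mathrm{inv}(T[\overrightarrow{C_3}]_n)=n+1$.
   Context: All digraphs are finite and have no loops, parallel arcs or 2-cycles (i.e. they are oriented graphs). $\overrightarrow{C_3}$ denotes the directed cycle on three vertices. For a digraph $D$ with vertex set $V(D)$ and a subset $X\subseteq V(D)$, the inversion of $X$ in $D$ is the digraph $\mathrm{Inv}(D;X)$ obtained from $D$ by reversing the direction of all arcs with both ends in $X$. For a finite family $(X_i)_{i\in I}$ of subsets of $V(D)$, $\mathrm{Inv}(D;(X_i)_{i\in I})$ is obtained by inverting the sets $X_i$ one after another (the order does not matter). The family is a decycling family if $\mathrm{Inv}(D;(X_i)_{i\in I})$ is acyclic. The inversion number $\mathrm{inv}(D)$ is the minimum cardinality $|I|$ of a decycling family of $D$. Blow-up graph: let $H$ be a digraph with vertices labelled $v_1,\dots,v_n$, and let $D_1,\dots,D_n$ be pairwise vertex-disjoint digraphs. The blow-up $H[D_1,\dots,D_n]$ is the digraph with vertex set $\bigcup_{i=1}^n V(D_i)$ and arc set $\bigcup_{v_iv_j\in A(H)}\{xy : x\in V(D_i),\ y\in V(D_j)\}\cup\bigcup_{k=1}^n A(D_k)$, where $A(\cdot)$ denotes the arc set. If all $D_i$ are (disjoint copies of) the same digraph $D$, the blow-up is denoted $H[D]_n$. *)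

theory Defs
  imports "Graph_Theory.Pair_Digraph" "HOL-Library.Disjoint_Sets"
begin

text \<open>
  Digraphs are the pair digraphs of the Graph Theory entry of the AFP. Their arc set is a relation,
  so there are no parallel arcs; the locale \<open>pair_digraph\<close> adds well-formedness, finiteness and
  the absence of loops.
\<close>

locale oriented_graph = pair_digraph +
  assumes no_2cycles: "(u, v) \<in> parcs G \<Longrightarrow> (v, u) \<notin> parcs G"

locale tournament = oriented_graph +
  assumes adjacent: "\<lbrakk>u \<in> pverts G; v \<in> pverts G; u \<noteq> v\<rbrakk> \<Longrightarrow> (u, v) \<in> parcs G \<or> (v, u) \<in> parcs G"

definition inversion :: "'a pair_pre_digraph \<Rightarrow> 'a set \<Rightarrow> 'a pair_pre_digraph" where
  "inversion D X = D\<lparr>parcs :=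
     {(u, v). (u, v) \<in> parcs D \<and> \<not> (u \<in> X \<and> v \<in> X)}
     \<union> {(v, u) | u v. (u, v) \<in> parcs D \<and> u \<in> X \<and> v \<in> X}\<rparr>"

text \<open>A family of \<open>k\<close> vertex sets, possibly with repetitions, is a list of length \<open>k\<close>.\<close>

definition inversions :: "'a pair_pre_digraph \<Rightarrow> 'a set list \<Rightarrow> 'a pair_pre_digraph" where
  "inversions D Xs = foldl inversion D Xs"

definition decycling_family :: "'a pair_pre_digraph \<Rightarrow> 'a set list \<Rightarrow> bool" where
  "decycling_family D Xs \<longleftrightarrow>
     (\<forall>X \<in> set Xs. X \<subseteq> pverts D) \<and> acyclic (parcs (inversions D Xs))"

definition inversion_number :: "'a pair_pre_digraph \<Rightarrow> nat" where
  "inversion_number D = (LEAST k. \<exists>Xs. decycling_family D Xs \<and> length Xs = k)"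

text \<open>
  In the blow-up, \<open>l\<close> is the labelling of the vertices of \<open>H\<close> by \<open>1, \<dots>, n\<close>. The definition is
  meant for pairwise vertex-disjoint \<open>D 1, \<dots>, D n\<close>; in \<open>blowup_copies\<close>, which is \<open>H[D]\<^sub>n\<close>, the
  vertices of the \<open>i\<close>-th copy of \<open>D\<close> are tagged with \<open>i\<close> to make the copies disjoint.
\<close>

definition blowup ::
  "nat \<Rightarrow> (nat \<Rightarrow> 'a) \<Rightarrow> 'a pair_pre_digraph \<Rightarrow> (nat \<Rightarrow> 'b pair_pre_digraph) \<Rightarrow> 'b pair_pre_digraph" where
  "blowup n l H D = \<lparr>
     pverts = (\<Union>i \<in> {1..n}. pverts (D i)),
     parcs = (\<Union>(i, j) \<in> {(i, j). i \<in> {1..n} \<and> j \<in> {1..n} \<and> (l i, l j) \<in> parcs H}.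
                pverts (D i) \<times> pverts (D j))
             \<union> (\<Union>k \<in> {1..n}. parcs (D k))\<rparr>"

definition tagged_copy :: "nat \<Rightarrow> 'b pair_pre_digraph \<Rightarrow> (nat \<times> 'b) pair_pre_digraph" where
  "tagged_copy i D = \<lparr>
     pverts = (\<lambda>x. (i, x)) ` pverts D,
     parcs = (\<lambda>(x, y). ((i, x), (i, y))) ` parcs D\<rparr>"

definition blowup_copies ::
  "nat \<Rightarrow> (nat \<Rightarrow> 'a) \<Rightarrow> 'a pair_pre_digraph \<Rightarrow> 'b pair_pre_digraph \<Rightarrow> (nat \<times> 'b) pair_pre_digraph" where
  "blowup_copies n l H D = blowup n l H (\<lambda>i. tagged_copy i D)"

definition directed_C3 :: "nat pair_pre_digraph" where
  "directed_C3 = \<lparr>pverts = {0, 1, 2}, parcs = {(0, 1), (1, 2), (2, 0)}\<rparr>"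

lemma acyclic_iff_no_cycle:
  assumes "pair_wf_digraph D"
  shows "acyclic (parcs D) \<longleftrightarrow> (\<nexists>p. pre_digraph.cycle (with_proj D) p)"
proof -
  interpret pair_wf_digraph D by fact
  show ?thesis
  proof
    assume ac: "acyclic (parcs D)"
    show "\<nexists>p. pre_digraph.cycle (with_proj D) p"
    proof
      assume "\<exists>p. pre_digraph.cycle (with_proj D) p"
      then obtain u p where "awalk u p u" "p \<noteq> []" by (auto simp: cycle_def)
      then have "(u,u) \<in> (parcs D)^+" by (metis reachable1_awalkI with_proj_simps(3))
      with ac show False by (auto simp: acyclic_def)
    qed
  next
    assume nc: "\<nexists>p. pre_digraph.cycle (with_proj D) p"
    show "acyclic (parcs D)" unfolding acyclic_def
    proof (intro allI notI)
      fix x assume "(x,x) \<in> (parcs D)^+"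
      then obtain p where "awalk x p x" "p \<noteq> []" by (metis reachable1_awalk with_proj_simps(3))
      then have "closed_w p" by (auto simp: closed_w_def)
      with closed_w_imp_cycle nc show False by auto
    qed
  qed
qed

lemma inversion_oriented:
  assumes "oriented_graph D" shows "oriented_graph (inversion D X)"
proof -
  interpret oriented_graph D by fact
  have "finite (parcs (inversion D X))"
    by (rule finite_subset[of _ "parcs D \<union> (parcs D)\<inverse>"]) (auto simp: inversion_def pair_finite_arcs)
  then show ?thesis
    by unfold_locales
      (auto simp: inversion_def pair_finite_verts no_2cycles dest: in_arcsD1 in_arcsD2 no_loops')
qed

lemma ex_decycling:
  fixes D :: "'a pair_pre_digraph"
  assumes "oriented_graph D" shows "\<exists>Xs. decycling_family D Xs"
proof -
  interpret D: oriented_graph D by fact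
  have "finite (pverts D)" by (rule D.pair_finite_verts)
  then obtain f :: "_ \<Rightarrow> nat" where f: "inj_on f (pverts D)"
    by (meson finite_imp_inj_to_nat_seg)
  define B where "B E = {(u,v) \<in> parcs E. f v < f u}" for E :: "'a pair_pre_digraph"
  have "\<exists>Xs. decycling_family E Xs" if "oriented_graph E" "pverts E = pverts D" for E
    using that
  proof (induction "card (B E)" arbitrary: E rule: less_induct)
    case less
    interpret E: oriented_graph E by fact
    have fB: "finite (B E)" unfolding B_def by (rule finite_subset[OF _ E.pair_finite_arcs]) auto
    show ?case
    proof (cases "B E = {}")
      case True
      have "parcs E \<subseteq> inv_image less_than f"
      proof safe
        fix u v assume uv: "(u,v) \<in> parcs E"
        then have "u \<noteq> v" "u \<in> pverts D" "v \<in> pverts D" 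
          using E.in_arcsD1 E.in_arcsD2 E.no_loops' less.prems by auto
        then have "f u \<noteq> f v" using f by (auto dest: inj_onD)
        then show "(u,v) \<in> inv_image less_than f" using uv True by (force simp: B_def)
      qed
      then have "acyclic (parcs E)"
        by (meson acyclic_subset wf_acyclic wf_inv_image wf_less_than)
      then have "decycling_family E []" by (simp add: decycling_family_def inversions_def)
      then show ?thesis by blast
    next
      case False
      then obtain u v where uv: "(u,v) \<in> parcs E" "f v < f u" by (auto simp: B_def)
      let ?X = "{u,v}"
      have "B (inversion E ?X) \<subseteq> B E"
        using uv E.no_loops' by (auto simp: B_def inversion_def)
      moreover have "(u, v) \<in> B E - B (inversion E ?X)"
        using uv E.no_2cycles[OF uv(1)] by (auto simp: B_def inversion_def)
      ultimately have "B (inversion E ?X) \<subset> B E" by blast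
      then have "card (B (inversion E ?X)) < card (B E)" using fB psubset_card_mono by blast
      moreover have "pverts (inversion E ?X) = pverts D" using less.prems by (simp add: inversion_def)
      ultimately obtain Xs where "decycling_family (inversion E ?X) Xs"
        using less.hyps[of "inversion E ?X"] inversion_oriented[OF less.prems(1)] by blast
      then have "decycling_family E (?X # Xs)"
        using E.in_arcsD1 E.in_arcsD2 uv by (auto simp: decycling_family_def inversions_def inversion_def)
      then show ?thesis by blast
    qed
  qed
  with assms show ?thesis by blast
qed

end

theory Submission
  imports Defs "HOL-Library.Z2"
begin

text \<open>
  Why \<open>n + 1\<close> inversions suffice: make each \<open>D\<^sub>i\<close> acyclic by one set of its own, and then invert the
  union of those parts whose vertex of \<open>T\<close> lies in a set \<open>Y\<close> that decycles \<open>T\<close>. The last inversion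
  acts on \<open>T\<close> as \<open>Y\<close> does, and inside a part it either does nothing or reverses every arc, which
  keeps the part acyclic (\<open>ex_decycling_family\<close>).

  Why \<open>n\<close> do not: given \<open>k\<close> sets that decycle the blow-up, attach to every vertex its
  characteristic vector in \<open>\<bbbF>\<^sub>2\<^sup>k\<close>, the list of the sets that contain it. An arc is reversed iff its
  ends have inner product \<open>1\<close>. Fix a linear extension of the resulting acyclic digraph. Since
  \<open>D\<^sub>i\<close> is not acyclic, it has three vertices \<open>x\<^sub>i < y\<^sub>i < z\<^sub>i\<close> that behave as a directed triangle in
  which the inversions have destroyed the cycle (\<open>sorted_triangle\<close>). Differences are easier to handle
  than vertices: for \<open>v\<close> outside \<open>D\<^sub>i\<close>, the product of \<open>x\<^sub>i + y\<^sub>i\<close> with \<open>v\<close> only says whether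
  \<open>v\<close> lies between \<open>x\<^sub>i\<close> and \<open>y\<^sub>i\<close>, whatever \<open>T\<close> is; yet its product with \<open>z\<^sub>i\<close> is \<open>1\<close>.
  So a sum of vectors \<open>x\<^sub>i + y\<^sub>i\<close> has product \<open>1\<close> with the last of the \<open>z\<^sub>i\<close> involved: these \<open>n\<close>
  vectors are independent, and so are the \<open>y\<^sub>i + z\<^sub>i\<close>. Hence \<open>k \<ge> n\<close>, and if \<open>k = n\<close> both families
  are bases.

  In that case the configuration is rigid. One shows \<open>x\<^sub>i = z\<^sub>i\<close> for all \<open>i\<close>, by induction on the
  position of \<open>z\<^sub>i\<close> (\<open>all_collapsed\<close>). Then no chosen vertex outside \<open>D\<^sub>i\<close> lies between \<open>x\<^sub>i\<close>
  and \<open>z\<^sub>i\<close>, the basis \<open>x\<^sub>i + y\<^sub>i\<close> is orthonormal, and \<open>x\<^sub>i\<close> coincides with its member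
  \<open>x\<^sub>i + y\<^sub>i\<close>. So the \<open>x\<^sub>i\<close> are pairwise orthogonal, no arc between them is reversed, and their order
  is a linear extension of \<open>T\<close> (\<open>T_iff_x_less\<close>). But \<open>T\<close> is not acyclic, so \<open>k \<ge> n + 1\<close>
  (\<open>decycling_family_length\<close>).
\<close>

section \<open>Linear algebra over the field with two elements\<close>

(* As rewrite rules these turn sums and products of bits into bit operations,
   so that the laws of rings no longer apply to them. *)
declare add_bit_eq_xor [simp del] mult_bit_eq_and [simp del]

lemma bit_add_eq_0_iff: "a + b = 0 \<longleftrightarrow> a = b" for a b :: bit
  by (cases a; cases b) simp_all

definition dot :: "'c set \<Rightarrow> ('c \<Rightarrow> bit) \<Rightarrow> ('c \<Rightarrow> bit) \<Rightarrow> bit" where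
  "dot K u v = (\<Sum>c\<in>K. u c * v c)"

definition vadd :: "('c \<Rightarrow> bit) \<Rightarrow> ('c \<Rightarrow> bit) \<Rightarrow> 'c \<Rightarrow> bit" where
  "vadd u v = (\<lambda>c. u c + v c)"

definition vsum :: "('i \<Rightarrow> 'c \<Rightarrow> bit) \<Rightarrow> 'i set \<Rightarrow> 'c \<Rightarrow> bit" where
  "vsum a S = (\<lambda>c. \<Sum>i\<in>S. a i c)"

lemma dot_commute: "dot K u v = dot K v u"
  by (simp add: dot_def mult.commute)

lemma dot_vadd: "dot K (vadd u v) w = dot K u w + dot K v w"
  by (simp add: dot_def vadd_def ring_distribs sum.distrib)

lemma dot_vsum: "dot K (vsum a S) w = (\<Sum>i\<in>S. dot K (a i) w)"
  unfolding dot_def vsum_def sum_distrib_right by (rule sum.swap)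

lemma sum_bit_symdiff:
  fixes g :: "'i \<Rightarrow> bit"
  assumes "finite A" "finite B"
  shows "sum g (A - B \<union> (B - A)) = sum g A + sum g B"
proof -
  have "sum g A = sum g (A - B) + sum g (A \<inter> B)" "sum g B = sum g (B - A) + sum g (A \<inter> B)"
    using assms sum.Int_Diff[of A g B] sum.Int_Diff[of B g A] by (simp_all add: Int_commute add.commute)
  moreover have "sum g (A - B \<union> (B - A)) = sum g (A - B) + sum g (B - A)"
    using assms by (intro sum.union_disjoint) auto
  ultimately show ?thesis
    by (cases "sum g (A \<inter> B)") (simp_all add: algebra_simps)
qed

text \<open>
  Pigeonhole: there are more subsets of the index set than vectors, so two of them have the same
  sum, and then their symmetric difference sums to zero.
\<close>

lemma linear_dependence:
  fixes a :: "'i \<Rightarrow> 'c \<Rightarrow> bit"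
  assumes "finite I" "finite K" "card K < card I"
  obtains S where "S \<subseteq> I" "S \<noteq> {}" "\<And>c. c \<in> K \<Longrightarrow> vsum a S c = 0"
proof -
  define F where "F S = restrict (vsum a S) K" for S
  have "(UNIV :: bit set) = {0, 1}" by (auto intro: bit.exhaust)
  then have "card (UNIV :: bit set) = 2" by (metis card_2_iff zero_neq_one)
  then have target: "card (K \<rightarrow>\<^sub>E (UNIV :: bit set)) = 2 ^ card K"
    using assms by (simp add: card_PiE)
  then have fin: "finite (K \<rightarrow>\<^sub>E (UNIV :: bit set))"
    using card.infinite by fastforce
  have "\<not> inj_on F (Pow I)"
  proof
    assume "inj_on F (Pow I)"
    moreover have "F ` Pow I \<subseteq> K \<rightarrow>\<^sub>E UNIV" by (auto simp: F_def)
    ultimately have "card (Pow I) \<le> card (K \<rightarrow>\<^sub>E (UNIV :: bit set))"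
      using fin card_inj_on_le by blast
    with assms target show False by (simp add: card_Pow)
  qed
  then obtain A B where AB: "A \<subseteq> I" "B \<subseteq> I" "A \<noteq> B" "F A = F B"
    by (auto simp: inj_on_def)
  show thesis
  proof (rule that)
    show "A - B \<union> (B - A) \<subseteq> I" "A - B \<union> (B - A) \<noteq> {}" using AB by auto
    fix c assume "c \<in> K"
    then have "vsum a A c = vsum a B c" using AB(4) by (metis F_def restrict_apply')
    moreover have "finite A" "finite B" using AB assms finite_subset by auto
    ultimately show "vsum a (A - B \<union> (B - A)) c = 0"
      by (simp add: vsum_def sum_bit_symdiff bit_add_eq_0_iff)
  qed
qed

text \<open>
  A linearly independent family with at least as many members as there are coordinates spans, since
  adding one more vector forces a dependence. The equation is stated through inner products, which
  is how it is always used.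
\<close>

lemma independent_imp_spanning:
  fixes a :: "'i \<Rightarrow> 'c \<Rightarrow> bit"
  assumes "finite I" "finite K" "card K \<le> card I"
    and indep: "\<And>S. \<lbrakk>S \<subseteq> I; S \<noteq> {}\<rbrakk> \<Longrightarrow> \<exists>v. dot K (vsum a S) v \<noteq> 0"
  obtains S where "S \<subseteq> I" "\<And>v. dot K w v = (\<Sum>i\<in>S. dot K (a i) v)"
proof -
  define a' where "a' o_i = (case o_i of None \<Rightarrow> w | Some i \<Rightarrow> a i)" for o_i
  have "card (insert None (Some ` I)) = Suc (card I)"
    using assms by (subst card_insert_disjoint) (auto simp: card_image)
  then obtain R where R: "R \<subseteq> insert None (Some ` I)" "R \<noteq> {}"
      and zero: "\<And>c. c \<in> K \<Longrightarrow> vsum a' R c = 0"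
    using linear_dependence[of "insert None (Some ` I)" K a'] assms by auto
  define S where "S = {i. Some i \<in> R}"
  have S: "S \<subseteq> I" using R by (auto simp: S_def)
  then have finite_S: "finite S" using assms(1) finite_subset by blast
  have sum_Some: "(\<Sum>r\<in>Some ` S. dot K (a' r) v) = (\<Sum>i\<in>S. dot K (a i) v)" for v
    by (simp add: sum.reindex a'_def)
  have zero': "(\<Sum>r\<in>R. dot K (a' r) v) = 0" for v
    unfolding dot_vsum[symmetric] by (simp add: dot_def zero)
  have "None \<in> R"
  proof (rule ccontr)
    assume "None \<notin> R"
    then have "R = Some ` S" unfolding S_def using R by (auto simp: image_iff)
    then have "S \<noteq> {}" "\<And>v. dot K (vsum a S) v = 0"
      using R zero' sum_Some by (auto simp: dot_vsum)
    then show False using indep[OF S] by auto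
  qed
  then have R_eq: "R = insert None (Some ` S)"
    unfolding S_def using R by (auto simp: image_iff)
  have "dot K w v + (\<Sum>i\<in>S. dot K (a i) v) = 0" for v
    using zero'[of v] finite_S unfolding R_eq sum_Some[symmetric]
    by (subst (asm) sum.insert) (auto simp: a'_def)
  then show thesis using that S by (simp add: bit_add_eq_0_iff)
qed

lemma sum_bit_single:
  fixes g :: "'i \<Rightarrow> bit"
  assumes "finite S" "j \<in> S" "\<And>i. \<lbrakk>i \<in> S; i \<noteq> j\<rbrakk> \<Longrightarrow> g i = 0"
  shows "sum g S = g j"
  using assms by (subst sum.remove[of _ j]) auto

section \<open>Linearly ordered families of triangles\<close>

text \<open>
  Vertices are identified with their positions in the linear order, and \<open>f p\<close> is the characteristic
  vector of the vertex at position \<open>p\<close>. The two conditions \<open>triangle_yz\<close> and \<open>triangle_xz\<close> say that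
  the original arcs on \<open>x i < y i < z i\<close> form a directed cycle, of either orientation; \<open>outside\<close> says
  that for \<open>p\<close>, \<open>q\<close> in different triangles \<open>i\<close>, \<open>j\<close> the arc was reversed iff the order disagrees
  with \<open>T\<close>. The bound \<open>card_K\<close> is the assumption to be refuted in the application: there are no
  more inverted sets than triangles.
\<close>

locale triangle_system =
  fixes I :: "'i set" and K :: "'c set"
    and T :: "'i \<Rightarrow> 'i \<Rightarrow> bool"
    and x y z :: "'i \<Rightarrow> nat"
    and f :: "nat \<Rightarrow> 'c \<Rightarrow> bit"
  assumes finite_I: "finite I" and finite_K: "finite K" and card_K: "card K \<le> card I"
    and xy: "i \<in> I \<Longrightarrow> x i < y i" and yz: "i \<in> I \<Longrightarrow> y i < z i"
    and triangle_yz: "i \<in> I \<Longrightarrow> dot K (f (y i)) (f (z i)) = dot K (f (x i)) (f (y i))"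
    and triangle_xz: "i \<in> I \<Longrightarrow> dot K (f (x i)) (f (z i)) = 1 + dot K (f (x i)) (f (y i))"
    and outside_neq: "\<lbrakk>i \<in> I; j \<in> I; i \<noteq> j; p \<in> {x i, y i, z i}; q \<in> {x j, y j, z j}\<rbrakk> \<Longrightarrow> p \<noteq> q"
    and outside: "\<lbrakk>i \<in> I; j \<in> I; i \<noteq> j; p \<in> {x i, y i, z i}; q \<in> {x j, y j, z j}\<rbrakk>
      \<Longrightarrow> dot K (f p) (f q) = of_bool (T i j \<noteq> (p < q))"
begin

definition a where "a i = vadd (f (x i)) (f (y i))"
definition b where "b i = vadd (f (y i)) (f (z i))"
definition s where "s i = vadd (f (x i)) (f (z i))"

text \<open>
  Comparing \<open>q\<close> with two vertices of the same triangle cancels the contribution of \<open>T\<close>: only the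
  order is left.
\<close>

lemma a_outside:
  assumes "i \<in> I" "j \<in> I" "i \<noteq> j" "q \<in> {x j, y j, z j}"
  shows "dot K (a i) (f q) = of_bool (x i < q \<and> q < y i)"
proof -
  have "x i \<noteq> q" "y i \<noteq> q"
    using assms outside_neq[of i j "x i" q] outside_neq[of i j "y i" q] by simp_all
  moreover have "dot K (f (x i)) (f q) = of_bool (T i j \<noteq> (x i < q))"
    and "dot K (f (y i)) (f q) = of_bool (T i j \<noteq> (y i < q))"
    using assms outside[of i j "x i" q] outside[of i j "y i" q] by simp_all
  ultimately show ?thesis
    using assms(1) xy[of i] by (auto simp: a_def dot_vadd)
qed

lemma b_outside:
  assumes "i \<in> I" "j \<in> I" "i \<noteq> j" "q \<in> {x j, y j, z j}"
  shows "dot K (b i) (f q) = of_bool (y i < q \<and> q < z i)"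
proof -
  have "y i \<noteq> q" "z i \<noteq> q"
    using assms outside_neq[of i j "y i" q] outside_neq[of i j "z i" q] by simp_all
  moreover have "dot K (f (y i)) (f q) = of_bool (T i j \<noteq> (y i < q))"
    and "dot K (f (z i)) (f q) = of_bool (T i j \<noteq> (z i < q))"
    using assms outside[of i j "y i" q] outside[of i j "z i" q] by simp_all
  ultimately show ?thesis
    using assms(1) yz[of i] by (auto simp: b_def dot_vadd)
qed

lemma s_outside:
  assumes "i \<in> I" "j \<in> I" "i \<noteq> j" "q \<in> {x j, y j, z j}"
  shows "dot K (s i) (f q) = of_bool (x i < q \<and> q < z i)"
proof -
  have "x i \<noteq> q" "z i \<noteq> q"
    using assms outside_neq[of i j "x i" q] outside_neq[of i j "z i" q] by simp_all
  moreover have "dot K (f (x i)) (f q) = of_bool (T i j \<noteq> (x i < q))"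
    and "dot K (f (z i)) (f q) = of_bool (T i j \<noteq> (z i < q))"
    using assms outside[of i j "x i" q] outside[of i j "z i" q] by simp_all
  ultimately show ?thesis
    using assms(1) xy[of i] yz[of i] by (auto simp: s_def dot_vadd)
qed

lemma a_z: "i \<in> I \<Longrightarrow> dot K (a i) (f (z i)) = 1"
  using triangle_xz[of i] triangle_yz[of i] by (cases "dot K (f (x i)) (f (y i))") (auto simp: a_def dot_vadd)

lemma b_x: "i \<in> I \<Longrightarrow> dot K (b i) (f (x i)) = 1"
  using triangle_xz[of i] by (cases "dot K (f (x i)) (f (y i))") (auto simp: b_def dot_vadd dot_commute[of K _ "f (x i)"])

lemma s_eq: "dot K (s i) v = dot K (a i) v + dot K (b i) v"
  by (cases "dot K (f (y i)) v") (auto simp: a_def b_def s_def dot_vadd algebra_simps)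

lemma ex_max:
  fixes h :: "'i \<Rightarrow> nat"
  assumes "S \<subseteq> I" "S \<noteq> {}"
  obtains j where "j \<in> S" "\<And>i. i \<in> S \<Longrightarrow> h i \<le> h j"
proof -
  have "finite S" using assms finite_I finite_subset by auto
  then have "Max (h ` S) \<in> h ` S" "\<And>i. i \<in> S \<Longrightarrow> h i \<le> Max (h ` S)" using assms by auto
  then show thesis using that by (metis imageE)
qed

lemma ex_min:
  fixes h :: "'i \<Rightarrow> nat"
  assumes "S \<subseteq> I" "S \<noteq> {}"
  obtains j where "j \<in> S" "\<And>i. i \<in> S \<Longrightarrow> h j \<le> h i"
proof -
  have "finite S" using assms finite_I finite_subset by auto
  then have "Min (h ` S) \<in> h ` S" "\<And>i. i \<in> S \<Longrightarrow> Min (h ` S) \<le> h i" using assms by auto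
  then show thesis using that by (metis imageE)
qed

text \<open>
  All intervals from \<open>x i\<close> to \<open>y i\<close> other than that of \<open>j\<close> end before \<open>z j\<close>, so only the triangle
  of \<open>j\<close> itself contributes.
\<close>

lemma sum_a_last_z:
  assumes "S \<subseteq> I" "j \<in> S" and last: "\<And>i. i \<in> S \<Longrightarrow> z i \<le> z j"
  shows "(\<Sum>i\<in>S. dot K (a i) (f (z j))) = 1"
proof -
  have "(\<Sum>i\<in>S. dot K (a i) (f (z j))) = dot K (a j) (f (z j))"
  proof (rule sum_bit_single)
    fix i assume i: "i \<in> S" "i \<noteq> j"
    then show "dot K (a i) (f (z j)) = 0"
      using a_outside[of i j "z j"] assms(1,2) last[OF i(1)] yz[of i] by (auto simp: subset_iff)
  qed (use assms finite_I finite_subset in auto)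
  then show ?thesis using a_z assms by auto
qed

lemma sum_b_first_x:
  assumes "S \<subseteq> I" "j \<in> S" and first: "\<And>i. i \<in> S \<Longrightarrow> x j \<le> x i"
  shows "(\<Sum>i\<in>S. dot K (b i) (f (x j))) = 1"
proof -
  have "(\<Sum>i\<in>S. dot K (b i) (f (x j))) = dot K (b j) (f (x j))"
  proof (rule sum_bit_single)
    fix i assume i: "i \<in> S" "i \<noteq> j"
    then show "dot K (b i) (f (x j)) = 0"
      using b_outside[of i j "x j"] assms(1,2) first[OF i(1)] xy[of i] by (auto simp: subset_iff)
  qed (use assms finite_I finite_subset in auto)
  then show ?thesis using b_x assms by auto
qed

lemma a_spans: "\<exists>S\<subseteq>I. \<forall>v. dot K w v = (\<Sum>i\<in>S. dot K (a i) v)"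
proof (rule independent_imp_spanning[of I K a w])
  fix S assume "S \<subseteq> I" "S \<noteq> {}"
  then show "\<exists>v. dot K (vsum a S) v \<noteq> 0"
    using ex_max[of S z] sum_a_last_z[of S] by (metis dot_vsum zero_neq_one)
qed (use finite_I finite_K card_K in auto)

lemma b_spans: "\<exists>S\<subseteq>I. \<forall>v. dot K w v = (\<Sum>i\<in>S. dot K (b i) v)"
proof (rule independent_imp_spanning[of I K b w])
  fix S assume "S \<subseteq> I" "S \<noteq> {}"
  then show "\<exists>v. dot K (vsum b S) v \<noteq> 0"
    using ex_min[of S x] sum_b_first_x[of S] by (metis dot_vsum zero_neq_one)
qed (use finite_I finite_K card_K in auto)

text \<open>
  The matrix of products of the \<open>f (z j)\<close> with the \<open>b l\<close> is triangular in the order of the \<open>z j\<close>,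
  and it is nonsingular since the \<open>b l\<close> span and the \<open>f (z j)\<close> are independent. So its diagonal
  entries are \<open>1\<close>: if the entry at \<open>i\<close> were \<open>0\<close>, the rows from \<open>i\<close> on would be supported on
  one column fewer than there are rows.
\<close>

lemma b_z:
  assumes i: "i \<in> I"
  shows "dot K (b i) (f (z i)) = 1"
proof (rule ccontr)
  assume "\<not> ?thesis"
  then have b_z_0: "dot K (b i) (f (z i)) = 0" by simp
  define J where "J = {j \<in> I. z i \<le> z j}"
  have J: "finite J" "i \<in> J" "J \<subseteq> I" using finite_I i by (auto simp: J_def)
  then have "card (J - {i}) < card J" by (intro card_Diff1_less)
  then obtain S where S: "S \<subseteq> J" "S \<noteq> {}"
      and dep: "\<And>l. l \<in> J - {i} \<Longrightarrow> vsum (\<lambda>j l. dot K (f (z j)) (b l)) S l = 0"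
    using linear_dependence[of J "J - {i}" "\<lambda>j l. dot K (f (z j)) (b l)"] J by auto
  define w where "w = vsum (\<lambda>j. f (z j)) S"
  have w_b: "dot K w (b l) = 0" if l: "l \<in> I" for l
  proof (cases "l \<in> J - {i}")
    case True
    then show ?thesis unfolding w_def dot_vsum using dep by (simp add: vsum_def)
  next
    case False
    then have late: "l = i \<or> z l < z i" using l by (auto simp: J_def)
    have "dot K (f (z j)) (b l) = 0" if "j \<in> S" for j
    proof -
      have "j \<in> I" "z i \<le> z j" using that S by (auto simp: J_def)
      then show ?thesis
        using b_outside[OF l, of j "z j"] b_z_0 late
        by (cases "j = l") (auto simp: dot_commute[of K _ "b _"])
    qed
    then show ?thesis by (simp add: w_def dot_vsum)
  qed
  have null: "dot K w v = 0" for v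
  proof -
    obtain R where "R \<subseteq> I" "dot K v w = (\<Sum>l\<in>R. dot K (b l) w)"
      using b_spans[of v] by metis
    moreover have "(\<Sum>l\<in>R. dot K (b l) w) = 0"
      using w_b \<open>R \<subseteq> I\<close> by (intro sum.neutral) (auto simp: dot_commute[of K _ w])
    ultimately show ?thesis by (simp add: dot_commute[of K w])
  qed
  obtain l where l: "l \<in> S" "\<And>j. j \<in> S \<Longrightarrow> z l \<le> z j" using ex_min[of S z] S J by blast
  have SI: "S \<subseteq> I" using S J by auto
  have "(\<Sum>j\<in>S. dot K (f (z j)) (a l)) = dot K (f (z l)) (a l)"
  proof (rule sum_bit_single)
    fix j assume "j \<in> S" "j \<noteq> l"
    then show "dot K (f (z j)) (a l) = 0"
      using a_outside[of l j "z j"] l(1) l(2)[of j] SI yz[of l]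
      by (auto simp: dot_commute[of K _ "a l"] subset_iff)
  qed (use SI finite_I finite_subset l in auto)
  moreover have "dot K (f (z l)) (a l) = 1" using a_z[of l] l SI by (auto simp: dot_commute)
  ultimately show False using null[of "a l"] by (simp add: w_def dot_vsum)
qed

text \<open>
  As the form is nondegenerate, this says that \<open>x i\<close> and \<open>z i\<close> carry the same vector. Then the two
  ends of the triangle cannot be told apart from outside, so that no other triangle has a vertex
  between them.
\<close>

definition collapsed where "collapsed i \<longleftrightarrow> (\<forall>v. dot K (s i) v = 0)"

lemma collapsed_a_outside:
  assumes "i \<in> I" "collapsed i" "j \<in> I" "i \<noteq> j" "q \<in> {x j, y j, z j}"
  shows "dot K (a i) (f q) = 0"
  using assms s_outside[of i j q] a_outside[of i j q] yz[of i] by (auto simp: collapsed_def)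

lemma collapsed_a_a:
  assumes "i \<in> I" "collapsed i" "j \<in> I" "i \<noteq> j"
  shows "dot K (a j) (a i) = 0"
  using collapsed_a_outside[OF assms] by (simp add: a_def[of j] dot_vadd dot_commute[of K _ "a i"])

text \<open>
  \<open>a i\<close> is orthogonal to all other \<open>a j\<close>; if it were orthogonal to itself, it would be orthogonal to
  the whole space, against \<open>a_z\<close>.
\<close>

lemma collapsed_a_unit:
  assumes i: "i \<in> I" "collapsed i"
  shows "dot K (a i) (a i) = 1"
proof (rule ccontr)
  assume "\<not> ?thesis"
  then have "dot K (a j) (a i) = 0" if "j \<in> I" for j
    using collapsed_a_a[OF i that] by (cases "i = j") auto
  moreover obtain S where "S \<subseteq> I" "dot K (f (z i)) (a i) = (\<Sum>j\<in>S. dot K (a j) (a i))"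
    using a_spans[of "f (z i)"] by metis
  ultimately have "dot K (f (z i)) (a i) = 0" by (metis (no_types, lifting) subsetD sum.neutral)
  then show False using a_z[OF i(1)] by (simp add: dot_commute[of K "a i"])
qed

lemma collapsed_a_coefficient:
  assumes "i \<in> I" "collapsed i" "S \<subseteq> I" "i \<in> S"
  shows "(\<Sum>j\<in>S. dot K (a j) (a i)) = 1"
proof -
  have "(\<Sum>j\<in>S. dot K (a j) (a i)) = dot K (a i) (a i)"
    using assms finite_I finite_subset by (intro sum_bit_single) (auto intro!: collapsed_a_a)
  then show ?thesis using collapsed_a_unit assms by simp
qed

text \<open>
  Expand \<open>s i\<close> in the basis \<open>a\<close>. The members \<open>a j\<close> with \<open>z j < z i\<close> do not occur, since by
  induction they are unit vectors orthogonal to the rest of the basis and to \<open>s i\<close>. If any other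
  member occurs, let \<open>j\<close> be the last one: then \<open>s i\<close> has product \<open>1\<close> with \<open>z j\<close>, although
  \<open>z j\<close> is not inside the triangle of \<open>i\<close>. For \<open>j = i\<close>, this is where \<open>b_z\<close> is needed.
\<close>

lemma all_collapsed: "i \<in> I \<Longrightarrow> collapsed i"
proof (induction "z i" arbitrary: i rule: less_induct)
  case less
  obtain S where S: "S \<subseteq> I" and s: "\<forall>v. dot K (s i) v = (\<Sum>j\<in>S. dot K (a j) v)"
    using a_spans[of "s i"] by blast
  have late: "z i \<le> z j" if "j \<in> S" for j
  proof (rule ccontr)
    assume "\<not> z i \<le> z j"
    then have j: "j \<in> I" "collapsed j" "j \<noteq> i"
      using less.hyps[of j] S that by (auto simp: subset_iff)
    then have "dot K (s i) (a j) = 0"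
      using less.prems collapsed_a_outside[of j i] by (simp add: s_def dot_vadd dot_commute[of K _ "a j"])
    moreover have "dot K (s i) (a j) = 1"
      using s collapsed_a_coefficient[OF j(1,2) S that] by simp
    ultimately show False by simp
  qed
  have "S = {}"
  proof (rule ccontr)
    assume "S \<noteq> {}"
    then obtain j where j: "j \<in> S" "\<And>l. l \<in> S \<Longrightarrow> z l \<le> z j" using ex_max[of S z] S by blast
    then have 1: "dot K (s i) (f (z j)) = 1" unfolding s[rule_format] using sum_a_last_z[OF S] by simp
    show False
    proof (cases "i = j")
      case True
      then show ?thesis using 1 s_eq[of i "f (z i)"] a_z[OF less.prems] b_z[OF less.prems] by simp
    next
      case False
      have "j \<in> I" "z i \<le> z j" using j S late by auto
      then show ?thesis using 1 s_outside[of i j "z j"] less.prems False by simp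
    qed
  qed
  then show ?case using s by (simp add: collapsed_def)
qed

text \<open>
  \<open>x i\<close> is orthogonal to all \<open>a l\<close> with \<open>l \<noteq> i\<close>, and the \<open>a l\<close> form an orthonormal basis by now, so
  \<open>x i\<close> is a multiple of \<open>a i\<close>. As \<open>a i\<close> is orthogonal to \<open>x j\<close>, so is \<open>x i\<close>: the order of
  \<open>x i\<close> and \<open>x j\<close> agrees with \<open>T\<close>.
\<close>

theorem T_iff_x_less:
  assumes i: "i \<in> I" and j: "j \<in> I" and "i \<noteq> j"
  shows "T i j \<longleftrightarrow> x i < x j"
proof -
  obtain S where S: "S \<subseteq> I" and x: "\<forall>v. dot K (f (x i)) v = (\<Sum>l\<in>S. dot K (a l) v)"
    using a_spans[of "f (x i)"] by blast
  have "S \<subseteq> {i}"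
  proof
    fix l assume l: "l \<in> S"
    then have "l \<in> I" using S by auto
    have "dot K (f (x i)) (a l) = 1"
      unfolding x[rule_format] using collapsed_a_coefficient[OF \<open>l \<in> I\<close> all_collapsed S l] \<open>l \<in> I\<close> by simp
    then show "l \<in> {i}"
      using collapsed_a_outside[of l i "x i"] all_collapsed[of l] \<open>l \<in> I\<close> i
      by (auto simp: dot_commute[of K "a l"])
  qed
  moreover have "dot K (a i) (f (x j)) = 0"
    using collapsed_a_outside[of i j "x j"] all_collapsed[OF i] assms by simp
  ultimately have "dot K (f (x i)) (f (x j)) = 0"
    unfolding x[rule_format] by (intro sum.neutral) auto
  then show ?thesis using outside[of i j "x i" "x j"] assms by auto
qed

end

section \<open>Acyclic relations and rank functions\<close>

lemma acyclic_if_rank: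
  assumes "wf s" and "\<And>u v. (u, v) \<in> r \<Longrightarrow> (rank u, rank v) \<in> s"
  shows "acyclic r"
proof -
  have "r \<subseteq> inv_image s rank" using assms(2) by auto
  then show ?thesis using assms(1) wf_inv_image wf_subset wf_acyclic by metis
qed

lemma acyclic_imp_injective_rank:
  assumes "finite V" "r \<subseteq> V \<times> V" "acyclic r"
  shows "\<exists>pos :: 'v \<Rightarrow> nat. inj_on pos V \<and> (\<forall>(u, v)\<in>r. pos u < pos v)"
proof -
  define N where "N = card V"
  obtain e where e: "bij_betw e V {0..<N}"
    using ex_bij_betw_finite_nat[OF assms(1)] by (auto simp: N_def)
  define h where "h v = card {w. (w, v) \<in> r\<^sup>+}" for v
  (* Counting predecessors gives a rank; the enumeration e breaks ties to make it injective. *)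
  define pos where "pos v = h v * N + e v" for v
  have e_less: "e v < N" if "v \<in> V" for v using e that by (auto simp: bij_betw_def)
  have trancl_V: "r\<^sup>+ \<subseteq> V \<times> V" using assms(2) by (rule trancl_subset_Sigma)
  have "inj_on pos V"
  proof (rule inj_onI)
    fix u v assume uv: "u \<in> V" "v \<in> V" "pos u = pos v"
    then have "e u = e v" using e_less[of u] e_less[of v] unfolding pos_def
      by (metis mod_less mod_mult_self3)
    then show "u = v" using e uv by (auto simp: bij_betw_def dest: inj_onD)
  qed
  moreover have "pos u < pos v" if uv: "(u, v) \<in> r" for u v
  proof -
    have "{w. (w, u) \<in> r\<^sup>+} \<subset> {w. (w, v) \<in> r\<^sup>+}"
      using uv assms(3) by (auto simp: acyclic_def intro: trancl_into_trancl)
    moreover have "finite {w. (w, v) \<in> r\<^sup>+}"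
      by (rule finite_subset[OF _ assms(1)]) (use trancl_V in auto)
    ultimately have "Suc (h u) \<le> h v" unfolding h_def by (meson Suc_leI psubset_card_mono)
    then have "Suc (h u) * N \<le> h v * N" by (rule mult_le_mono1)
    then show ?thesis using e_less[of u] uv assms(2) by (auto simp: pos_def)
  qed
  ultimately show ?thesis by blast
qed

lemma triangle_if_not_acyclic:
  assumes "r \<subseteq> V \<times> V"
    and total: "\<And>u v. \<lbrakk>u \<in> V; v \<in> V; u \<noteq> v\<rbrakk> \<Longrightarrow> (u, v) \<in> r \<or> (v, u) \<in> r"
    and asym: "\<And>u v. (u, v) \<in> r \<Longrightarrow> (v, u) \<notin> r"
    and "\<not> acyclic r"
  shows "\<exists>u v w. (u, v) \<in> r \<and> (v, w) \<in> r \<and> (w, u) \<in> r"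
proof -
  have "\<not> trans r"
  proof
    assume "trans r"
    then show False using \<open>\<not> acyclic r\<close> asym by (auto simp: acyclic_def trancl_id)
  qed
  then obtain u v w where "(u, v) \<in> r" "(v, w) \<in> r" "(u, w) \<notin> r"
    by (auto simp: trans_def)
  moreover from this have "u \<noteq> w" using asym by blast
  ultimately show ?thesis using total assms(1) by blast
qed

text \<open>
  A pair is to be reversed iff \<open>c\<close> is \<open>1\<close> on it. Orient every pair of vertices so that this reversal
  puts it in the order of \<open>pos\<close>; by \<open>rank\<close> the result is a tournament that extends \<open>r\<close>. So it has a
  directed triangle, even where \<open>r\<close> itself has only longer cycles, and listing its vertices by
  \<open>pos\<close> gives the two equations for \<open>c\<close>, for both orientations of the triangle.
\<close>

lemma sorted_triangle:
  fixes c :: "'v \<Rightarrow> 'v \<Rightarrow> bit" and pos :: "'v \<Rightarrow> nat"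
  assumes "r \<subseteq> V \<times> V" "\<not> acyclic r" and inj: "inj_on pos V"
    and sym: "\<And>u v. c u v = c v u"
    and rank: "\<And>u v. (u, v) \<in> r \<Longrightarrow> if c u v = 0 then pos u < pos v else pos v < pos u"
  obtains x y z where "x \<in> V" "y \<in> V" "z \<in> V" "pos x < pos y" "pos y < pos z"
    "c y z = c x y" "c x z = 1 + c x y"
proof -
  note result = that
  define R where "R = {(u, v). u \<in> V \<and> v \<in> V \<and> (if c u v = 0 then pos u < pos v else pos v < pos u)}"
  have "r \<subseteq> R" using assms(1) rank by (auto simp: R_def)
  then have "\<not> acyclic R" using assms(2) acyclic_subset by blast
  moreover have "(u, v) \<in> R \<or> (v, u) \<in> R" if uv: "u \<in> V" "v \<in> V" "u \<noteq> v" for u v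
  proof -
    have "pos u \<noteq> pos v" using inj uv by (auto dest: inj_onD)
    then show ?thesis using uv sym[of u v] by (auto simp: R_def)
  qed
  moreover have "(v, u) \<notin> R" if "(u, v) \<in> R" for u v
    using that sym[of u v] by (auto simp: R_def split: if_splits)
  moreover have "R \<subseteq> V \<times> V" by (auto simp: R_def)
  ultimately obtain u v w where uvw: "(u, v) \<in> R" "(v, w) \<in> R" "(w, u) \<in> R"
    using triangle_if_not_acyclic[of R V] by blast
  have sorted: thesis if "(p, q) \<in> R" "(q, t) \<in> R" "(t, p) \<in> R" "pos p < pos q" "pos p < pos t" for p q t
  proof (cases "pos q < pos t")
    case True
    then show thesis using that(1-5) sym[of t p]
      by (intro result[of p q t]) (auto simp: R_def split: if_splits)
  next
    case False
    then show thesis using that(1-5) sym[of t p] sym[of q t]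
      by (intro result[of p t q]) (auto simp: R_def split: if_splits)
  qed
  have "pos u \<noteq> pos v" "pos v \<noteq> pos w" "pos w \<noteq> pos u"
    using uvw by (auto simp: R_def split: if_splits)
  then consider "pos u < pos v" "pos u < pos w" | "pos v < pos w" "pos v < pos u"
    | "pos w < pos u" "pos w < pos v" by linarith
  then show thesis using sorted uvw by cases blast+
qed

section \<open>Inversions\<close>

definition coords :: "'v set list \<Rightarrow> 'v \<Rightarrow> nat \<Rightarrow> bit" where
  "coords Xs u = (\<lambda>c. of_bool (u \<in> Xs ! c))"

text \<open>The number of sets that contain both vertices, modulo two.\<close>

abbreviation flips :: "'v set list \<Rightarrow> 'v \<Rightarrow> 'v \<Rightarrow> bit" where
  "flips Xs u v \<equiv> dot {..<length Xs} (coords Xs u) (coords Xs v)"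

lemma flips_eq_sum_list: "flips Xs u v = (\<Sum>X\<leftarrow>Xs. of_bool (u \<in> X \<and> v \<in> X))"
  by (simp add: sum_list_sum_nth dot_def coords_def lessThan_atLeast0 of_bool_conj)

lemma arc_inversion:
  "(u, v) \<in> parcs (inversion D X) \<longleftrightarrow> (if u \<in> X \<and> v \<in> X then (v, u) \<in> parcs D else (u, v) \<in> parcs D)"
  by (auto simp: inversion_def)

lemma arc_inversions:
  "(u, v) \<in> parcs (inversions D Xs) \<longleftrightarrow> (if flips Xs u v = 0 then (u, v) \<in> parcs D else (v, u) \<in> parcs D)"
proof -
  have "\<forall>u v. (u, v) \<in> parcs (inversions D Xs) \<longleftrightarrow>
      (if (\<Sum>X\<leftarrow>Xs. of_bool (u \<in> X \<and> v \<in> X)) = (0 :: bit) then (u, v) \<in> parcs D else (v, u) \<in> parcs D)"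
  proof (induction Xs rule: rev_induct)
    case Nil
    then show ?case by (simp add: inversions_def)
  next
    case (snoc X Xs)
    have "inversions D (Xs @ [X]) = inversion (inversions D Xs) X" by (simp add: inversions_def)
    then show ?case by (auto simp: arc_inversion snoc.IH conj_commute)
  qed
  then show ?thesis by (simp add: flips_eq_sum_list)
qed

lemma inversion_number_le: "decycling_family D Xs \<Longrightarrow> inversion_number D \<le> length Xs"
  unfolding inversion_number_def by (rule Least_le) blast

lemma inversion_number_attained:
  assumes "decycling_family D Ys"
  obtains Xs where "decycling_family D Xs" "length Xs = inversion_number D"
proof -
  have "\<exists>Xs. decycling_family D Xs \<and> length Xs = inversion_number D"
    unfolding inversion_number_def by (rule LeastI_ex) (use assms in blast)
  then show thesis using that by blast
qed

lemma acyclic_imp_inversion_number_0: "acyclic (parcs D) \<Longrightarrow> inversion_number D = 0"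
  using inversion_number_le[of D "[]"] by (simp add: decycling_family_def inversions_def)

lemma inversion_number_1_decycling_set:
  assumes "oriented_graph D" "inversion_number D = 1"
  obtains X where "X \<subseteq> pverts D" "acyclic (parcs (inversion D X))"
proof -
  obtain Xs where "decycling_family D Xs" "length Xs = 1"
    using ex_decycling[OF assms(1)] inversion_number_attained assms(2) by metis
  then show thesis using that
    by (auto simp: decycling_family_def inversions_def length_Suc_conv)
qed

section \<open>The inversion number of a blow-up\<close>

lemma (in pair_digraph) arcs_subset: "parcs G \<subseteq> pverts G \<times> pverts G"
  using in_arcsD1 in_arcsD2 by auto

locale tournament_blowup = T: tournament T for T :: "'a pair_pre_digraph" +
  fixes n :: nat and l :: "nat \<Rightarrow> 'a" and D :: "nat \<Rightarrow> 'b pair_pre_digraph"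
  assumes bij_l: "bij_betw l {1..n} (pverts T)"
    and oriented: "i \<in> {1..n} \<Longrightarrow> oriented_graph (D i)"
    and disjoint: "disjoint_family_on (\<lambda>i. pverts (D i)) {1..n}"
begin

abbreviation "B \<equiv> blowup n l T D"

lemma part_unique: "\<lbrakk>i \<in> {1..n}; j \<in> {1..n}; u \<in> pverts (D i); u \<in> pverts (D j)\<rbrakk> \<Longrightarrow> i = j"
  using disjoint unfolding disjoint_family_on_def by blast

lemma pverts_B: "pverts B = (\<Union>i\<in>{1..n}. pverts (D i))"
  by (simp add: blowup_def)

lemma finite_B: "finite (pverts B)"
proof -
  have "finite (pverts (D i))" if "i \<in> {1..n}" for i
  proof -
    interpret oriented_graph "D i" using oriented that .
    show ?thesis by (rule pair_finite_verts)
  qed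
  then show ?thesis by (auto simp: pverts_B)
qed

lemma part_arcs_subset:
  assumes "i \<in> {1..n}"
  shows "parcs (D i) \<subseteq> pverts (D i) \<times> pverts (D i)"
proof -
  interpret oriented_graph "D i" using oriented assms .
  show ?thesis by (rule arcs_subset)
qed

lemma arcs_B_subset: "parcs B \<subseteq> pverts B \<times> pverts B"
  using part_arcs_subset by (fastforce simp: blowup_def)

lemma arc_B:
  assumes "i \<in> {1..n}" "j \<in> {1..n}" "u \<in> pverts (D i)" "v \<in> pverts (D j)"
  shows "(u, v) \<in> parcs B \<longleftrightarrow> (if i = j then (u, v) \<in> parcs (D i) else (l i, l j) \<in> parcs T)"
proof -
  have across: "(u, v) \<in> (\<Union>(i, j) \<in> {(i, j). i \<in> {1..n} \<and> j \<in> {1..n} \<and> (l i, l j) \<in> parcs T}.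
      pverts (D i) \<times> pverts (D j)) \<longleftrightarrow> (l i, l j) \<in> parcs T"
    using assms part_unique by blast
  have inside: "(u, v) \<in> (\<Union>k\<in>{1..n}. parcs (D k)) \<longleftrightarrow> i = j \<and> (u, v) \<in> parcs (D i)"
  proof
    assume "(u, v) \<in> (\<Union>k\<in>{1..n}. parcs (D k))"
    then obtain k where k: "k \<in> {1..n}" "(u, v) \<in> parcs (D k)" by blast
    then have "u \<in> pverts (D k)" "v \<in> pverts (D k)" using part_arcs_subset by auto
    then have "i = k" "j = k" using part_unique k(1) assms by blast+
    then show "i = j \<and> (u, v) \<in> parcs (D i)" using k by simp
  qed (use assms in blast)
  have "(l i, l i) \<notin> parcs T" using T.no_2cycles by blast
  then show ?thesis using across inside by (auto simp: blowup_def)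
qed

text \<open>
  If there were at most \<open>n\<close> sets, the sorted triangles of the parts would form a
  \<open>triangle_system\<close>, and the positions of the vertices \<open>x i\<close> would rank the vertices of \<open>T\<close>.
\<close>

lemma decycling_family_length:
  assumes T: "\<not> acyclic (parcs T)" and D: "\<And>i. i \<in> {1..n} \<Longrightarrow> \<not> acyclic (parcs (D i))"
    and Xs: "decycling_family B Xs"
  shows "n < length Xs"
proof (rule ccontr)
  assume short: "\<not> n < length Xs"
  let ?V = "pverts B" and ?R = "parcs (inversions B Xs)"
  have R_subset: "?R \<subseteq> ?V \<times> ?V" using arcs_B_subset by (auto simp: arc_inversions split: if_splits)
  have "acyclic ?R" using Xs by (simp add: decycling_family_def)
  from acyclic_imp_injective_rank[OF finite_B R_subset this]
  obtain pos :: "'b \<Rightarrow> nat" where inj: "inj_on pos ?V" and pos: "\<And>u v. (u, v) \<in> ?R \<Longrightarrow> pos u < pos v"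
    by blast
  have rank: "if flips Xs u v = 0 then pos u < pos v else pos v < pos u" if "(u, v) \<in> parcs B" for u v
  proof (cases "flips Xs u v = 0")
    case True
    then show ?thesis using that by (simp add: pos arc_inversions)
  next
    case False
    then have "flips Xs v u \<noteq> 0" by (simp add: dot_commute[of _ "coords Xs v"])
    then show ?thesis using that False by (simp add: pos arc_inversions)
  qed
  define sorted where "sorted i x y z \<longleftrightarrow>
      x \<in> pverts (D i) \<and> y \<in> pverts (D i) \<and> z \<in> pverts (D i) \<and> pos x < pos y \<and> pos y < pos z
      \<and> flips Xs y z = flips Xs x y \<and> flips Xs x z = 1 + flips Xs x y" for i x y z
  have "\<exists>x y z. sorted i x y z" if i: "i \<in> {1..n}" for i
  proof -
    have "inj_on pos (pverts (D i))"
      by (rule inj_on_subset[OF inj]) (use i in \<open>auto simp: pverts_B\<close>)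
    moreover have "if flips Xs u v = 0 then pos u < pos v else pos v < pos u"
      if "(u, v) \<in> parcs (D i)" for u v
      using that i part_arcs_subset arc_B[of i i u v] by (intro rank) auto
    ultimately show ?thesis
      unfolding sorted_def
      using sorted_triangle[OF part_arcs_subset[OF i] D[OF i], of pos "flips Xs"] dot_commute by metis
  qed
  then obtain x y z where "\<And>i. i \<in> {1..n} \<Longrightarrow> sorted i (x i) (y i) (z i)" by metis
  then have xyz: "x i \<in> pverts (D i)" "y i \<in> pverts (D i)" "z i \<in> pverts (D i)"
    and less: "pos (x i) < pos (y i)" "pos (y i) < pos (z i)"
    and flips: "flips Xs (y i) (z i) = flips Xs (x i) (y i)" "flips Xs (x i) (z i) = 1 + flips Xs (x i) (y i)"
    if "i \<in> {1..n}" for i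
    using that by (simp_all add: sorted_def)
  define f where "f p = coords Xs (inv_into ?V pos p)" for p
  have f: "f (pos u) = coords Xs u" if "i \<in> {1..n}" "u \<in> pverts (D i)" for i u
  proof -
    have "u \<in> ?V" using that by (auto simp: pverts_B)
    then show ?thesis by (simp add: f_def inv_into_f_f[OF inj])
  qed
  have outside: "pos u \<noteq> pos v \<and> flips Xs u v = of_bool (((l i, l j) \<in> parcs T) \<noteq> (pos u < pos v))"
    if ij: "i \<in> {1..n}" "j \<in> {1..n}" "i \<noteq> j" and uv: "u \<in> pverts (D i)" "v \<in> pverts (D j)" for i j u v
  proof -
    have "l i \<in> pverts T" "l j \<in> pverts T" "l i \<noteq> l j"
      using bij_l ij by (auto simp: bij_betw_def dest: inj_onD)
    then consider "(l i, l j) \<in> parcs T" | "(l j, l i) \<in> parcs T" "(l i, l j) \<notin> parcs T"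
      using T.adjacent by blast
    then show ?thesis
    proof cases
      case 1
      then show ?thesis using rank[of u v] arc_B ij uv by (auto split: if_splits)
    next
      case 2
      then show ?thesis using rank[of v u] arc_B ij uv
        by (auto simp: dot_commute[of _ "coords Xs v"] split: if_splits)
    qed
  qed
  interpret triangle_system "{1..n}" "{..<length Xs}" "\<lambda>i j. (l i, l j) \<in> parcs T"
    "pos \<circ> x" "pos \<circ> y" "pos \<circ> z" f
  proof
    fix i j p q
    assume ij: "i \<in> {1..n}" "j \<in> {1..n}" "i \<noteq> j"
      and p: "p \<in> {(pos \<circ> x) i, (pos \<circ> y) i, (pos \<circ> z) i}"
      and q: "q \<in> {(pos \<circ> x) j, (pos \<circ> y) j, (pos \<circ> z) j}"
    from p xyz[OF ij(1)] obtain u where u: "u \<in> pverts (D i)" "p = pos u" by auto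
    from q xyz[OF ij(2)] obtain v where v: "v \<in> pverts (D j)" "q = pos v" by auto
    show "p \<noteq> q" and "dot {..<length Xs} (f p) (f q) = of_bool (((l i, l j) \<in> parcs T) \<noteq> (p < q))"
      using outside[OF ij u(1) v(1)] f ij u v by auto
  qed (use short less flips f xyz in auto)
  have "acyclic (parcs T)"
  proof (rule acyclic_if_rank[OF wf_less_than])
    fix u v assume uv: "(u, v) \<in> parcs T"
    then have "u \<in> l ` {1..n}" "v \<in> l ` {1..n}"
      using bij_l T.arcs_subset by (auto simp: bij_betw_def)
    then obtain i j where ij: "i \<in> {1..n}" "j \<in> {1..n}" "u = l i" "v = l j" by blast
    moreover have "i \<noteq> j" using uv ij T.no_2cycles by auto
    ultimately have "pos (x i) < pos (x j)" using T_iff_x_less[of i j] uv by simp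
    moreover have "inv_into {1..n} l u = i" "inv_into {1..n} l v = j"
      using ij bij_l by (auto simp: bij_betw_def)
    ultimately show "((\<lambda>u. pos (x (inv_into {1..n} l u))) u, (\<lambda>u. pos (x (inv_into {1..n} l u))) v) \<in> less_than"
      by simp
  qed
  with T show False by simp
qed

text \<open>
  The result is ranked lexicographically: by part, in an order for \<open>T\<close> with \<open>Y\<close> inverted, and
  within a part by a rank for \<open>D i\<close> with \<open>X i\<close> inverted, taken backwards if the last set contains
  the whole part.
\<close>

lemma ex_decycling_family:
  assumes Y: "Y \<subseteq> pverts T" "acyclic (parcs (inversion T Y))"
    and X: "\<And>i. i \<in> {1..n} \<Longrightarrow> X i \<subseteq> pverts (D i) \<and> acyclic (parcs (inversion (D i) (X i)))"
  shows "decycling_family B (map X [1..<Suc n] @ [\<Union>i\<in>{i\<in>{1..n}. l i \<in> Y}. pverts (D i)])"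
    (is "decycling_family B ?Xs")
proof -
  let ?Q = "\<lambda>i. if l i \<in> Y then (parcs (inversion (D i) (X i)))\<inverse> else parcs (inversion (D i) (X i))"
  have "parcs (inversion T Y) \<subseteq> pverts T \<times> pverts T"
    using T.arcs_subset by (auto simp: arc_inversion split: if_splits)
  from acyclic_imp_injective_rank[OF T.pair_finite_verts this Y(2)]
  obtain pT :: "'a \<Rightarrow> nat" where pT: "\<And>u v. (u, v) \<in> parcs (inversion T Y) \<Longrightarrow> pT u < pT v"
    by blast
  have "\<exists>p :: 'b \<Rightarrow> nat. \<forall>u v. (u, v) \<in> ?Q i \<longrightarrow> p u < p v" if i: "i \<in> {1..n}" for i
  proof -
    have "finite (pverts (D i))" using finite_B i by (auto simp: pverts_B intro: finite_subset)
    moreover have "?Q i \<subseteq> pverts (D i) \<times> pverts (D i)"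
      using part_arcs_subset[OF i] by (auto simp: arc_inversion split: if_splits)
    moreover have "acyclic (?Q i)" using X[OF i] by (auto simp: acyclic_converse)
    ultimately obtain p :: "'b \<Rightarrow> nat" where "\<forall>(u, v)\<in>?Q i. p u < p v"
      using acyclic_imp_injective_rank[of "pverts (D i)" "?Q i"] by blast
    then show ?thesis by blast
  qed
  then obtain p :: "nat \<Rightarrow> 'b \<Rightarrow> nat"
    where p: "\<And>i u v. \<lbrakk>i \<in> {1..n}; (u, v) \<in> ?Q i\<rbrakk> \<Longrightarrow> p i u < p i v" by metis
  define part where "part u = (THE i. i \<in> {1..n} \<and> u \<in> pverts (D i))" for u
  have part: "part u = i" if "i \<in> {1..n}" "u \<in> pverts (D i)" for i u
    unfolding part_def using that part_unique by blast
  have flips: "flips ?Xs u v =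
      (if i = j then of_bool (u \<in> X i \<and> v \<in> X i) else 0) + of_bool (l i \<in> Y \<and> l j \<in> Y)"
    if ij: "i \<in> {1..n}" "j \<in> {1..n}" and uv: "u \<in> pverts (D i)" "v \<in> pverts (D j)" for i j u v
  proof -
    have only_part: "u \<in> X c \<and> v \<in> X c \<longleftrightarrow> c = i \<and> c = j \<and> u \<in> X i \<and> v \<in> X i" if "c \<in> {1..n}" for c
      using X[OF that] part_unique[OF that ij(1)] part_unique[OF that ij(2)] uv by blast
    have "(\<Sum>X\<leftarrow>map X [1..<Suc n]. of_bool (u \<in> X \<and> v \<in> X)) = (\<Sum>c\<in>{1..n}. of_bool (u \<in> X c \<and> v \<in> X c) :: bit)"
      by (simp add: interv_sum_list_conv_sum_set_nat comp_def atLeastLessThanSuc_atLeastAtMost del: upt_Suc)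
    also have "\<dots> = (\<Sum>c\<in>{1..n}. if c = i then (if i = j then of_bool (u \<in> X i \<and> v \<in> X i) else 0) else 0)"
    proof (rule sum.cong)
      fix c assume "c \<in> {1..n}"
      then show "(of_bool (u \<in> X c \<and> v \<in> X c) :: bit)
          = (if c = i then (if i = j then of_bool (u \<in> X i \<and> v \<in> X i) else 0) else 0)"
        using only_part[of c] by (cases "c = i"; cases "i = j") simp_all
    qed simp
    also have "\<dots> = (if i = j then of_bool (u \<in> X i \<and> v \<in> X i) else 0)" using ij by simp
    finally have 1: "(\<Sum>X\<leftarrow>map X [1..<Suc n]. of_bool (u \<in> X \<and> v \<in> X))
        = (if i = j then of_bool (u \<in> X i \<and> v \<in> X i) else (0 :: bit))" .
    have 2: "u \<in> (\<Union>i\<in>{i\<in>{1..n}. l i \<in> Y}. pverts (D i)) \<longleftrightarrow> l i \<in> Y"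
      "v \<in> (\<Union>i\<in>{i\<in>{1..n}. l i \<in> Y}. pverts (D i)) \<longleftrightarrow> l j \<in> Y"
      using ij uv part_unique by blast+
    show ?thesis
      unfolding flips_eq_sum_list map_append sum_list_append 1
      by (simp only: list.map sum_list.Cons sum_list.Nil 2 add_0_right)
  qed
  have "acyclic (parcs (inversions B ?Xs))"
  proof (rule acyclic_if_rank)
    show "wf (less_than <*lex*> less_than)" by (intro wf_lex_prod wf_less_than)
    fix u v assume uv: "(u, v) \<in> parcs (inversions B ?Xs)"
    then have "(u, v) \<in> parcs B \<or> (v, u) \<in> parcs B" unfolding arc_inversions by (auto split: if_splits)
    then have "u \<in> pverts B" "v \<in> pverts B" using arcs_B_subset by auto
    then obtain i j where ij: "i \<in> {1..n}" "j \<in> {1..n}" and in_part: "u \<in> pverts (D i)" "v \<in> pverts (D j)"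
      unfolding pverts_B by blast
    have "if i = j then (u, v) \<in> ?Q i else (l i, l j) \<in> parcs (inversion T Y)"
      using uv unfolding arc_inversions flips[OF ij in_part] arc_B[OF ij in_part] arc_B[OF ij(2,1) in_part(2,1)]
      by (cases "i = j") (auto simp: arc_inversion split: if_splits)
    then have "i = j \<and> p i u < p i v \<or> pT (l i) < pT (l j)"
      using p[OF ij(1)] pT by (auto split: if_splits)
    then show "((\<lambda>u. (pT (l (part u)), p (part u) u)) u, (\<lambda>u. (pT (l (part u)), p (part u) u)) v)
        \<in> less_than <*lex*> less_than"
      using part ij in_part by auto
  qed
  moreover have "\<forall>X\<in>set ?Xs. X \<subseteq> pverts B" using X by (fastforce simp: pverts_B simp del: upt_Suc)
  ultimately show ?thesis by (simp add: decycling_family_def del: upt_Suc)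
qed

theorem inversion_number_blowup:
  assumes T: "inversion_number T = 1" and D: "\<And>i. i \<in> {1..n} \<Longrightarrow> inversion_number (D i) = 1"
  shows "inversion_number B = n + 1"
proof (rule antisym)
  obtain Y where Y: "Y \<subseteq> pverts T" "acyclic (parcs (inversion T Y))"
    using inversion_number_1_decycling_set[OF T.oriented_graph_axioms T] .
  have "\<exists>X. X \<subseteq> pverts (D i) \<and> acyclic (parcs (inversion (D i) X))" if "i \<in> {1..n}" for i
    using inversion_number_1_decycling_set[OF oriented D] that by metis
  then obtain X where X: "\<And>i. i \<in> {1..n} \<Longrightarrow> X i \<subseteq> pverts (D i) \<and> acyclic (parcs (inversion (D i) (X i)))"
    by metis
  note family = ex_decycling_family[OF Y X]
  show "inversion_number B \<le> n + 1"
    using inversion_number_le[OF family] by (simp del: upt_Suc)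
  obtain Xs where Xs: "decycling_family B Xs" "length Xs = inversion_number B"
    using inversion_number_attained[OF family] .
  have "\<not> acyclic (parcs T)" "\<And>i. i \<in> {1..n} \<Longrightarrow> \<not> acyclic (parcs (D i))"
    using acyclic_imp_inversion_number_0 T D by force+
  then show "n + 1 \<le> inversion_number B"
    using decycling_family_length[OF _ _ Xs(1)] Xs(2) by simp
qed

end

lemma oriented_graph_tagged_C3: "oriented_graph (tagged_copy i directed_C3)"
proof
qed (simp_all add: tagged_copy_def directed_C3_def, auto)

lemma inversion_number_tagged_C3: "inversion_number (tagged_copy i directed_C3) = 1"
proof -
  let ?C = "tagged_copy i directed_C3"
  have arcs: "parcs ?C = {((i, 0), (i, 1)), ((i, 1), (i, 2)), ((i, 2), (i, 0))}"
    by (simp add: tagged_copy_def directed_C3_def)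
  have "acyclic (parcs (inversion ?C {(i, 0), (i, 1)}))"
  proof (rule acyclic_if_rank[OF wf_less_than])
    fix u v assume "(u, v) \<in> parcs (inversion ?C {(i, 0), (i, 1)})"
    (* The cycle 0, 1, 2 becomes the transitive tournament on 1, 2, 0, in this order. *)
    then show "((\<lambda>u. (snd u + 2) mod 3) u, (\<lambda>u. (snd u + 2) mod 3) v) \<in> less_than"
      by (simp add: arc_inversion arcs split: if_splits) force+
  qed
  then have "decycling_family ?C [{(i, 0), (i, 1)}]"
    by (auto simp: decycling_family_def inversions_def tagged_copy_def directed_C3_def)
  note family = this
  have le: "inversion_number ?C \<le> 1" using inversion_number_le[OF family] by simp
  obtain Xs where attained: "decycling_family ?C Xs" "length Xs = inversion_number ?C"
    using inversion_number_attained[OF family] .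
  have "((i, 0), (i, 1)) \<in> parcs ?C" "((i, 1), (i, 2)) \<in> parcs ?C" "((i, 2), (i, 0)) \<in> parcs ?C"
    by (simp_all add: arcs)
  then have "((i, 0), (i, 0)) \<in> (parcs ?C)\<^sup>+" by (rule trancl.intros(2)[OF trancl.intros(2)[OF trancl.intros(1)]])
  then have "\<not> acyclic (parcs ?C)" by (auto simp: acyclic_def)
  then have "Xs \<noteq> []"
    using attained(1) by (auto simp: decycling_family_def inversions_def)
  then have "inversion_number ?C \<noteq> 0" using attained(2) by (metis length_0_conv)
  with le show ?thesis by simp
qed

theorem theorem1p13:
  fixes T :: "'a pair_pre_digraph" and n :: nat and l :: "nat \<Rightarrow> 'a"
  assumes "tournament T"
    and "card (pverts T) = n"
    and "bij_betw l {1..n} (pverts T)"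
    and "inversion_number T = 1"
  shows "(\<forall>D :: nat \<Rightarrow> 'b pair_pre_digraph.
            (\<forall>i \<in> {1..n}. oriented_graph (D i) \<and> inversion_number (D i) = 1) \<longrightarrow>
            disjoint_family_on (\<lambda>i. pverts (D i)) {1..n} \<longrightarrow>
            inversion_number (blowup n l T D) = n + 1) \<and>
         inversion_number (blowup_copies n l T directed_C3) = n + 1"
proof (intro conjI allI impI)
  fix D :: "nat \<Rightarrow> 'b pair_pre_digraph"
  assume D: "\<forall>i \<in> {1..n}. oriented_graph (D i) \<and> inversion_number (D i) = 1"
    and "disjoint_family_on (\<lambda>i. pverts (D i)) {1..n}"
  then interpret tournament_blowup T n l D
    using assms(1,3) by (intro tournament_blowup.intro tournament_blowup_axioms.intro) auto
  show "inversion_number (blowup n l T D) = n + 1"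
    by (rule inversion_number_blowup) (use assms(4) D in auto)
next
  interpret tournament_blowup T n l "\<lambda>i. tagged_copy i directed_C3"
    using assms(1,3) oriented_graph_tagged_C3
    by (intro tournament_blowup.intro tournament_blowup_axioms.intro)
      (auto simp: disjoint_family_on_def tagged_copy_def)
  show "inversion_number (blowup_copies n l T directed_C3) = n + 1"
    unfolding blowup_copies_def
    by (rule inversion_number_blowup) (use assms(4) inversion_number_tagged_C3 in auto)
qed

end
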